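(* Let $d\ge 1$, let $V$ be a $d$-dimensional real inner-product space, $\mathcal L\subset V$ a full-rank lattice, $\boldsymbol\alpha\in V$, and let $q_1<q_2<\cdots$ be the (finite or infinite) sequence of best approximation denominators of $\boldsymbol\alpha$ with respect to $\mathcal L$. Put $M=2^d$. For every $n\ge 1$ such that $q_{n+M}$ is defined, at least one of the following alternatives holds: (1) $q_{n+M}\ge 2q_{n+1}$; (2) the set $\{1,\ldots,M\}$ can be partitioned into disjoint pairs $\{j,k\}$, $j<k$, such that each pair of the partition satisfies $q_{n+k}=q_n+q_{n+j}$. Consequently, for every $n\ge1$ such that $q_{n+M}$ is defined, $$ q_{n+M}\ge \min\{2q_{n+1},\ q_n+q_{n+M/2}\}\ge q_n+q_{n+1}>2q_n. $$
   Context: Let $\|\cdot\|$ be the norm induced by the inner product of $V$; a full-rank lattice is a discrete subgroup spanning $V$. For integers $q\ge 1$ put $\rho(q)=\min_{p\in\mathcal L}\|q\boldsymbol\alpha-p\|$, the distance from $q\boldsymbol\alpha$ to $\mathcal L$. The best approximation denominators are defined by $q_1=1$ and $$q_{n+1}=\min\{q\in\mathbb Z: q>q_n,\ \rho(q)<\rho(q_n)\}$$ whenever the set on the right is nonempty; if it is empty, the sequence terminates at $q_n$. (The sequence is infinite if $\boldsymbol\alpha+\mathcal L$ has infinite order in $V/\mathcal L$, and otherwise terminates at a denominator with $\rho=0$.) *)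

theory Defs
  imports "HOL-Analysis.Analysis" "HOL-Library.Disjoint_Sets"
begin

definition full_rank_lattice :: "'a::euclidean_space set \<Rightarrow> bool" where
  "full_rank_lattice L \<longleftrightarrow>
     0 \<in> L \<and> (\<forall>x\<in>L. \<forall>y\<in>L. x + y \<in> L) \<and> (\<forall>x\<in>L. - x \<in> L) \<and>
     discrete L \<and> span L = UNIV"

text \<open>\<^const>\<open>infdist\<close> is an infimum; for a lattice it is attained,
  see \<open>lattice_dist_attained\<close> below.\<close>

definition lattice_dist :: "'a::euclidean_space set \<Rightarrow> 'a \<Rightarrow> nat \<Rightarrow> real" where
  "lattice_dist L \<alpha> q = infdist (real q *\<^sub>R \<alpha>) L"

text \<open>The sequence of best approximation denominators starts at index 1, so index 0
  carries no value; \<^term>\<open>None\<close> also marks the indices after termination.\<close>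

fun best_denom :: "'a::euclidean_space set \<Rightarrow> 'a \<Rightarrow> nat \<Rightarrow> nat option" where
  "best_denom L \<alpha> 0 = None"
| "best_denom L \<alpha> (Suc 0) = Some 1"
| "best_denom L \<alpha> (Suc (Suc n)) =
     (case best_denom L \<alpha> (Suc n) of
        None \<Rightarrow> None
      | Some q \<Rightarrow>
          if \<exists>q'>q. lattice_dist L \<alpha> q' < lattice_dist L \<alpha> q
          then Some (LEAST q'. q < q' \<and> lattice_dist L \<alpha> q' < lattice_dist L \<alpha> q)
          else None)"

lemma full_rank_lattice_closed:
  assumes "full_rank_lattice L"
  shows "closed L"
proof -
  have "discrete L" and "0 \<in> L" using assms by (auto simp: full_rank_lattice_def)
  then obtain e where e: "e > 0" "\<And>y. y \<in> L \<Longrightarrow> dist 0 y < e \<Longrightarrow> y = 0"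
    unfolding discrete_def isolated_in_dist_Ex_iff by metis
  have "y = x" if "x \<in> L" "y \<in> L" "dist y x < e" for x y
  proof -
    have "y + (- x) \<in> L" using assms that unfolding full_rank_lattice_def by blast
    moreover have "dist 0 (y + (- x)) < e" using that(3) by (simp add: dist_norm norm_minus_commute)
    ultimately have "y + (- x) = 0" by (rule e(2))
    then show ?thesis by simp
  qed
  then show ?thesis using discrete_imp_closed[OF e(1)] by blast
qed

lemma lattice_dist_attained:
  assumes "full_rank_lattice L"
  obtains p where "p \<in> L" "lattice_dist L \<alpha> q = norm (real q *\<^sub>R \<alpha> - p)"
    "\<And>p'. p' \<in> L \<Longrightarrow> norm (real q *\<^sub>R \<alpha> - p) \<le> norm (real q *\<^sub>R \<alpha> - p')"
proof -
  have "L \<noteq> {}" using assms by (auto simp: full_rank_lattice_def)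
  then obtain p where p: "p \<in> L" "infdist (real q *\<^sub>R \<alpha>) L = dist (real q *\<^sub>R \<alpha>) p"
    using infdist_attains_inf[OF full_rank_lattice_closed[OF assms]] by blast
  show ?thesis
  proof (rule that)
    show "p \<in> L" by (fact p(1))
    show "lattice_dist L \<alpha> q = norm (real q *\<^sub>R \<alpha> - p)"
      using p(2) by (simp add: lattice_dist_def dist_norm)
    show "norm (real q *\<^sub>R \<alpha> - p) \<le> norm (real q *\<^sub>R \<alpha> - p')" if "p' \<in> L" for p'
      using infdist_le[OF that, of "real q *\<^sub>R \<alpha>"] p(2) by (simp add: dist_norm)
  qed
qed

end

theory Submission
  imports Defs
begin

text \<open>Each denominator is lifted to \<open>v i = (q (n + i), p i)\<close> in the group \<open>G = \<int> \<times> L\<close>, where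
  \<open>p i\<close> is a nearest lattice point. If \<open>q (n + M) < 2 q (n + 1)\<close>, halving a vector of \<open>2G\<close>
  gives a height too small to beat the error of \<open>v 0\<close>. Hence \<open>v 1, \<dots>, v M\<close> are incongruent
  modulo \<open>2G\<close>, and no three of them sum to an element of \<open>2G\<close>. They thus represent a sum-free
  half of the \<open>2M\<close> classes of \<open>G / 2G\<close>, that is, the complement of an index 2 subgroup. This
  subgroup contains the class of \<open>v 0\<close>, so translation by \<open>v 0\<close> pairs off the \<open>v j\<close>, and
  for a pair \<open>j < k\<close> the congruence \<open>v k \<equiv> v 0 + v j\<close> forces equality of heights.\<close>

section \<open>Lattices and their classes modulo 2\<close>

lemma lattice_sum_of_int:
  assumes L: "full_rank_lattice L" and "finite B" "B \<subseteq> L"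
  shows "(\<Sum>b\<in>B. of_int (k b) *\<^sub>R b) \<in> L"
proof -
  have zero: "0 \<in> L" and add: "\<And>x y. x \<in> L \<Longrightarrow> y \<in> L \<Longrightarrow> x + y \<in> L"
    and neg: "\<And>x. x \<in> L \<Longrightarrow> - x \<in> L"
    using L unfolding full_rank_lattice_def by blast+
  have nat_mult: "of_nat m *\<^sub>R b \<in> L" if "b \<in> L" for m b
    by (induction m) (use that zero add in \<open>auto simp: algebra_simps\<close>)
  have int_mult: "of_int z *\<^sub>R b \<in> L" if "b \<in> L" for z b
  proof (cases "0 \<le> z")
    case True
    then show ?thesis using nat_mult[OF that, of "nat z"] by simp
  next
    case False
    then show ?thesis using neg[OF nat_mult[OF that, of "nat (- z)"]] by simp
  qed
  from \<open>finite B\<close> \<open>B \<subseteq> L\<close> show ?thesis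
    by (induction B rule: finite_induct) (use zero add int_mult in auto)
qed

lemma finite_bounded_lattice:
  assumes "full_rank_lattice L" "S \<subseteq> L" "bounded S"
  shows "finite S"
proof -
  obtain r where "S \<subseteq> cball 0 r"
    using \<open>bounded S\<close> by (auto simp: bounded_iff subset_iff)
  then have "S \<subseteq> L \<inter> cball 0 r" using \<open>S \<subseteq> L\<close> by blast
  moreover have "compact (L \<inter> cball 0 r)"
    using full_rank_lattice_closed[OF assms(1)] closed_Int_compact compact_cball by blast
  moreover have "discrete (L \<inter> cball 0 r)"
    using assms(1) discrete_subset[of L] unfolding full_rank_lattice_def by blast
  ultimately show ?thesis
    using discrete_compact_finite_iff finite_subset by blast
qed

text \<open>No lattice basis is needed to bound the order of \<open>L / 2L\<close>: for linearly
  independent \<open>B \<subseteq> L\<close> spanning the space, reducing \<open>2x + s\<close> modulo the doubled sublattice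
  generated by \<open>B\<close> embeds \<open>S \<times> F\<close> into \<open>F \<times> Pow B\<close>, where \<open>F\<close> is the finite set of
  lattice points in the fundamental cell of \<open>B\<close>.\<close>

lemma card_incongruent_mod_2_le:
  fixes L :: "'a::euclidean_space set"
  assumes L: "full_rank_lattice L" and "S \<subseteq> L"
    and incongruent: "\<And>s t p. s \<in> S \<Longrightarrow> t \<in> S \<Longrightarrow> p \<in> L \<Longrightarrow> s - t = p + p \<Longrightarrow> s = t"
  shows "finite S \<and> card S \<le> 2 ^ DIM('a)"
proof -
  obtain B where B: "B \<subseteq> L" "independent B" "L \<subseteq> span B" "card B = dim L"
    by (rule basis_exists)
  have "span L = UNIV" using L by (simp add: full_rank_lattice_def)
  then have span_B: "span B = UNIV"
    by (metis B(3) span_minimal subspace_span top.extremum_uniqueI)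
  have "finite B" using B(2) by (rule finiteI_independent)
  have card_B: "card B = DIM('a)"
    using B(4) \<open>span L = UNIV\<close> by (metis dim_UNIV dim_span)
  have diff: "x - y \<in> L" if "x \<in> L" "y \<in> L" for x y
    using L that unfolding full_rank_lattice_def by (metis diff_conv_add_uminus)
  have add: "x + y \<in> L" if "x \<in> L" "y \<in> L" for x y
    using L that unfolding full_rank_lattice_def by blast
  have "0 \<in> L" using L unfolding full_rank_lattice_def by blast
  define c where "c = representation B"
  have c_add: "c (x + y) b = c x b + c y b" and c_diff: "c (x - y) b = c x b - c y b" for x y b
    by (simp_all add: c_def representation_add representation_diff B span_B)
  have expand: "(\<Sum>b\<in>B. c x b *\<^sub>R b) = x" for x
    unfolding c_def using sum_representation_eq[OF B(2) _ \<open>finite B\<close>, of x] span_B by simp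
  define fl where "fl x = (\<Sum>b\<in>B. of_int \<lfloor>c x b\<rfloor> *\<^sub>R b)" for x
  have fl_L: "fl x \<in> L" for x
    unfolding fl_def by (rule lattice_sum_of_int[OF L \<open>finite B\<close> B(1)])
  have c_fl: "c (fl x) b = of_int \<lfloor>c x b\<rfloor>" if "b \<in> B" for x b
    unfolding fl_def c_def using \<open>finite B\<close> B(2) span_B that
    by (simp add: representation_sum representation_scale representation_basis span_base
      sum.delta if_distrib cong: if_cong)
  define F where "F = {x \<in> L. \<forall>b\<in>B. 0 \<le> c x b \<and> c x b < 1}"
  have "bounded F"
  proof (rule boundedI)
    fix x assume "x \<in> F"
    have "norm x = norm (\<Sum>b\<in>B. c x b *\<^sub>R b)" by (simp add: expand)
    also have "\<dots> \<le> (\<Sum>b\<in>B. norm b)"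
      using \<open>x \<in> F\<close> by (intro sum_norm_le) (auto simp: F_def mult_left_le_one_le)
    finally show "norm x \<le> (\<Sum>b\<in>B. norm b)" .
  qed
  then have "finite F" using finite_bounded_lattice[OF L, of F] by (auto simp: F_def)
  have "0 \<in> F" using \<open>0 \<in> L\<close> by (simp add: F_def c_def representation_zero)
  have reduce: "y - fl y \<in> F" if "y \<in> L" for y
    using that fl_L diff by (auto simp: F_def c_diff c_fl) linarith
  \<comment> \<open>The first component is the residue of \<open>y\<close> in the cell; the second
    records the discarded part \<open>fl y\<close> modulo the doubled sublattice generated by
    \<open>B\<close>.\<close>
  define g where "g = (\<lambda>(s, x). (let y = x + x + s in (y - fl y, {b \<in> B. odd \<lfloor>c y b\<rfloor>})))"
  have "inj_on g (S \<times> F)"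
  proof (rule inj_onI, clarify)
    fix s x t y assume S: "s \<in> S" "t \<in> S" and F: "x \<in> F" "y \<in> F" and eq: "g (s, x) = g (t, y)"
    let ?a = "x + x + s" and ?b = "y + y + t"
    have fr: "?a - fl ?a = ?b - fl ?b"
      and par: "{b \<in> B. odd \<lfloor>c ?a b\<rfloor>} = {b \<in> B. odd \<lfloor>c ?b b\<rfloor>}"
      using eq by (simp_all add: g_def Let_def)
    \<comment> \<open>Equal parities make the floors differ by even integers, so the discarded parts
      differ by twice a lattice vector.\<close>
    define k where "k b = (\<lfloor>c ?a b\<rfloor> - \<lfloor>c ?b b\<rfloor>) div 2" for b
    have k: "real_of_int \<lfloor>c ?a b\<rfloor> - real_of_int \<lfloor>c ?b b\<rfloor> = of_int (k b) + of_int (k b)" if "b \<in> B" for b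
    proof -
      have "even (\<lfloor>c ?a b\<rfloor> - \<lfloor>c ?b b\<rfloor>)" using par that by auto
      then have "\<lfloor>c ?a b\<rfloor> - \<lfloor>c ?b b\<rfloor> = k b + k b" by (auto simp: k_def)
      then show ?thesis by (metis of_int_add of_int_diff)
    qed
    define w where "w = (\<Sum>b\<in>B. of_int (k b) *\<^sub>R b)"
    have "w \<in> L" unfolding w_def by (rule lattice_sum_of_int[OF L \<open>finite B\<close> B(1)])
    have "fl ?a - fl ?b = w + w"
      unfolding fl_def w_def sum_subtractf[symmetric] sum.distrib[symmetric]
      by (rule sum.cong) (simp_all only: k flip: scaleR_left_diff_distrib scaleR_add_left)
    then have dab: "?a - ?b = w + w" using fr by (simp add: algebra_simps)
    then have "s - t = (w - x + y) + (w - x + y)" by (simp add: algebra_simps)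
    moreover have "w - x + y \<in> L" using \<open>w \<in> L\<close> F add diff by (simp add: F_def)
    ultimately have "s = t" using incongruent S by blast
    have "c x b = c y b" if "b \<in> B" for b
    proof -
      have "c (?a - ?b) b = of_int (k b) + of_int (k b)"
        using arg_cong[OF fr, of "\<lambda>z. c z b"] k[OF that] by (simp add: c_diff c_fl that)
      then have "c x b - c y b = of_int (k b)" using \<open>s = t\<close> by (simp add: c_diff c_add)
      \<comment> \<open>Coordinates of points of the cell lie in [0,1), and here they differ by the
        integer \<open>k b\<close>, hence not at all.\<close>
      moreover have "\<bar>c x b - c y b\<bar> < 1" using F that by (force simp: F_def)
      ultimately have "\<bar>real_of_int (k b)\<bar> < 1" by simp
      then have "k b = 0" by linarith
      with \<open>c x b - c y b = of_int (k b)\<close> show ?thesis by simp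
    qed
    then have "x = y" using expand[of x] expand[of y] by (metis (no_types, lifting) sum.cong)
    with \<open>s = t\<close> show "s = t \<and> x = y" by simp
  qed
  moreover have "g ` (S \<times> F) \<subseteq> F \<times> Pow B"
    using \<open>S \<subseteq> L\<close> by (auto simp: g_def Let_def intro!: reduce add) (auto simp: F_def)
  moreover have "finite (F \<times> Pow B)" using \<open>finite F\<close> \<open>finite B\<close> by simp
  ultimately have fin: "finite (S \<times> F)" and "card (S \<times> F) \<le> card (F \<times> Pow B)"
    by (meson finite_surj inj_on_finite, meson card_inj_on_le)
  then have "card S * card F \<le> card F * 2 ^ DIM('a)"
    by (simp add: card_cartesian_product card_Pow \<open>finite B\<close> card_B)
  moreover have "card F > 0" using \<open>finite F\<close> \<open>0 \<in> F\<close> card_gt_0_iff by blast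
  ultimately have "card S \<le> 2 ^ DIM('a)" by simp
  moreover have "finite S" using fin \<open>0 \<in> F\<close> finite_cartesian_productD1 by blast
  ultimately show ?thesis by simp
qed

text \<open>Among indices whose integer components have equal parity, congruence is decided by the
  lattice component, so at most 2^d of them are pairwise incongruent. The two parities together
  allow at most 2 * 2^d, one less than the number of indices.\<close>

lemma lattice_pigeonhole_mod_2:
  fixes L :: "'a::euclidean_space set" and f :: "nat \<Rightarrow> int \<times> 'a"
  assumes L: "full_rank_lattice L" and f: "\<And>i. i \<le> 2 * 2 ^ DIM('a) \<Longrightarrow> f i \<in> UNIV \<times> L"
  shows "\<exists>i j. i < j \<and> j \<le> 2 * 2 ^ DIM('a) \<and> (\<exists>w\<in>UNIV \<times> L. f i - f j = w + w)"
proof (rule ccontr)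
  let ?I = "{..2 * 2 ^ DIM('a) :: nat}"
  assume contra: "\<not> ?thesis"
  have distinct: "i = j" if "i \<in> ?I" "j \<in> ?I" "f i - f j = w + w" "w \<in> UNIV \<times> L" for i j w
  proof (rule ccontr)
    assume "i \<noteq> j"
    have "- w \<in> UNIV \<times> L" using that(4) L by (auto simp: full_rank_lattice_def)
    moreover have "f j - f i = - w + - w" using that(3) by (simp add: algebra_simps)
    ultimately show False using contra that \<open>i \<noteq> j\<close> by (metis atMost_iff linorder_neqE_nat)
  qed
  have part: "card {i \<in> ?I. even (fst (f i)) = b} \<le> 2 ^ DIM('a)" for b
  proof -
    let ?J = "{i \<in> ?I. even (fst (f i)) = b}"
    have incong: "i = j" if "i \<in> ?J" "j \<in> ?J" "p \<in> L" "snd (f i) - snd (f j) = p + p" for i j p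
    proof -
      have "even (fst (f i) - fst (f j))" using that by auto
      then obtain m where "fst (f i) - fst (f j) = m + m" by (metis evenE mult_2)
      then have "f i - f j = (m, p) + (m, p)" using that by (simp add: prod_eq_iff)
      then show ?thesis using distinct[of i j "(m, p)"] that by auto
    qed
    have "0 \<in> L" using L by (simp add: full_rank_lattice_def)
    have "inj_on (\<lambda>i. snd (f i)) ?J" by (rule inj_onI) (use incong[OF _ _ \<open>0 \<in> L\<close>] in auto)
    moreover have "card ((\<lambda>i. snd (f i)) ` ?J) \<le> 2 ^ DIM('a)"
    proof (rule card_incongruent_mod_2_le[OF L, THEN conjunct2])
      show "(\<lambda>i. snd (f i)) ` ?J \<subseteq> L" using f by force
    qed (use incong in blast)
    ultimately show ?thesis by (simp add: card_image)
  qed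
  have "?I = {i \<in> ?I. even (fst (f i)) = True} \<union> {i \<in> ?I. even (fst (f i)) = False}" by auto
  then have "card ?I \<le> card {i \<in> ?I. even (fst (f i)) = True} + card {i \<in> ?I. even (fst (f i)) = False}"
    by (metis (no_types, lifting) card_Un_le)
  also have "\<dots> \<le> 2 ^ DIM('a) + 2 ^ DIM('a)" using part by (intro add_mono)
  finally show False by simp
qed

section \<open>Chains of best approximations in an abstract group\<close>

text \<open>Here \<open>h\<close> is the height (the denominator) and \<open>e\<close> the
  approximation error. The assumption \<open>short\<close> negates alternative (1), and
  \<open>pigeonhole\<close> says that G/2G has at most 2M classes without forming the
  quotient.\<close>

locale best_approximation_chain =
  fixes G :: "'g::ab_group_add set" and h :: "'g \<Rightarrow> int" and e :: "'g \<Rightarrow> 'v::real_inner"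
    and v :: "nat \<Rightarrow> 'g" and M :: nat
  assumes zero: "0 \<in> G" and diff: "\<And>x y. x \<in> G \<Longrightarrow> y \<in> G \<Longrightarrow> x - y \<in> G"
    and h_add: "\<And>x y. h (x + y) = h x + h y"
    and e_add: "\<And>x y. e (x + y) = e x + e y"
    and v_in: "\<And>i. i \<le> M \<Longrightarrow> v i \<in> G"
    and h_pos: "0 < h (v 0)"
    and h_less: "\<And>i j. i < j \<Longrightarrow> j \<le> M \<Longrightarrow> h (v i) < h (v j)"
    and e_less: "\<And>i j. i < j \<Longrightarrow> j \<le> M \<Longrightarrow> norm (e (v j)) < norm (e (v i))"
    and best: "\<And>i w. i < M \<Longrightarrow> w \<in> G \<Longrightarrow> h w \<noteq> 0 \<Longrightarrow> \<bar>h w\<bar> < h (v (Suc i)) \<Longrightarrow>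
      norm (e (v i)) \<le> norm (e w)"
    and short: "h (v M) < 2 * h (v 1)"
    and M_pos: "0 < M"
    and pigeonhole: "\<And>f :: nat \<Rightarrow> 'g. (\<And>i. i \<le> 2 * M \<Longrightarrow> f i \<in> G) \<Longrightarrow>
      \<exists>i j. i < j \<and> j \<le> 2 * M \<and> (\<exists>w\<in>G. f i - f j = w + w)"
begin

text \<open>This is membership in 2G. Since \<open>y + y\<close> lies in 2G for \<open>y\<close> in
  G, congruence of elements of G can be tested on sums as well as on differences.\<close>

definition even_in :: "'g \<Rightarrow> bool" where
  "even_in x \<longleftrightarrow> (\<exists>w\<in>G. x = w + w)"

lemma add: "x \<in> G \<Longrightarrow> y \<in> G \<Longrightarrow> x + y \<in> G"
  using diff[OF _ diff[OF zero]] by fastforce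

lemma h_diff: "h (x - y) = h x - h y"
  using h_add[of "x - y" y] by simp

lemma e_diff: "e (x - y) = e x - e y"
  using e_add[of "x - y" y] by simp

lemma even_in_double: "w \<in> G \<Longrightarrow> even_in (w + w)"
  by (auto simp: even_in_def)

lemma even_in_add: "even_in x \<Longrightarrow> even_in y \<Longrightarrow> even_in (x + y)"
  unfolding even_in_def
proof (elim bexE)
  fix a b assume "a \<in> G" "b \<in> G" "x = a + a" "y = b + b"
  then show "\<exists>w\<in>G. x + y = w + w" by (intro bexI[of _ "a + b"]) (auto simp: algebra_simps add)
qed

lemma even_in_diff: "even_in x \<Longrightarrow> even_in y \<Longrightarrow> even_in (x - y)"
  unfolding even_in_def
proof (elim bexE)
  fix a b assume "a \<in> G" "b \<in> G" "x = a + a" "y = b + b"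
  then show "\<exists>w\<in>G. x - y = w + w" by (intro bexI[of _ "a - b"]) (auto simp: algebra_simps diff)
qed

lemma h_bounds:
  assumes "i \<le> M"
  shows "0 < h (v i)" and "h (v i) < 2 * h (v 1)"
proof -
  show "0 < h (v i)" using assms h_pos h_less[of 0 i] by (cases "i = 0") auto
  show "h (v i) < 2 * h (v 1)" using assms short h_less[of i M] by (cases "i = M") auto
qed

text \<open>A half of \<open>v i\<close> would have positive height below \<open>h (v 1)\<close> but
  at most half the error of \<open>v 0\<close>, against minimality of \<open>v 0\<close>.\<close>

lemma not_even_in:
  assumes "i \<le> M"
  shows "\<not> even_in (v i)"
proof
  assume "even_in (v i)"
  then obtain w where w: "w \<in> G" "v i = w + w" by (auto simp: even_in_def)
  then have "norm (e (v 0)) \<le> norm (e w)"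
    using h_bounds[OF assms] M_pos by (intro best) (auto simp: h_add)
  moreover have "norm (e (v i)) = 2 * norm (e w)"
    using w by (simp add: e_add flip: scaleR_2)
  moreover have "norm (e (v i)) \<le> norm (e (v 0))"
    using e_less[of 0 i] assms by (cases "i = 0") auto
  \<comment> \<open>The error of \<open>v 0\<close> strictly exceeds that of \<open>v 1\<close>;
    here \<open>0 < M\<close> is needed.\<close>
  moreover have "0 < norm (e (v 0))"
    using e_less[of 0 1] M_pos by (smt (verit) One_nat_def Suc_leI norm_ge_zero zero_less_one)
  ultimately show False by linarith
qed

text \<open>A half of \<open>v j - v i\<close> would have positive height below
  \<open>h (v 1)\<close>, and an error of at most the mean of two errors, one of them strictly
  smaller than that of \<open>v 0\<close>.\<close>

lemma not_even_in_add:
  assumes "i < j" "j \<le> M"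
  shows "\<not> even_in (v i + v j)"
proof
  assume "even_in (v i + v j)"
  then have "even_in (v i + v j - (v i + v i))"
    using assms v_in by (intro even_in_diff even_in_double) auto
  then obtain w where w: "w \<in> G" "v j - v i = w + w" by (auto simp: even_in_def)
  have hw: "h (v j) - h (v i) = 2 * h w" using arg_cong[OF w(2), of h] by (simp add: h_add h_diff)
  have "norm (e (v 0)) \<le> norm (e w)"
    using h_bounds[of i] h_bounds[of j] h_less[OF assms] assms M_pos hw w by (intro best) auto
  moreover have "e (v j) - e (v i) = 2 *\<^sub>R e w"
    using arg_cong[OF w(2), of e] by (simp add: e_add e_diff scaleR_2)
  then have "2 * norm (e w) \<le> norm (e (v j)) + norm (e (v i))"
    by (metis norm_scaleR norm_triangle_ineq4 abs_numeral)
  moreover have "norm (e (v i)) \<le> norm (e (v 0))"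
    using e_less[of 0 i] assms by (cases "i = 0") auto
  ultimately show False using e_less[OF assms] by linarith
qed

text \<open>With \<open>x\<close>, \<open>y\<close>, \<open>z\<close> the half differences \<open>(v i + v j - v k) / 2\<close> etc., their pairwise
  sums are \<open>v i\<close>, \<open>v j\<close>, \<open>v k\<close>, so \<open>\<parallel>x + y + z\<parallel>\<^sup>2\<close> is the sum of the three squared errors
  minus \<open>\<parallel>x\<parallel>\<^sup>2 + \<parallel>y\<parallel>\<^sup>2 + \<parallel>z\<parallel>\<^sup>2\<close>. Minimality of the chain makes this negative unless
  \<open>x\<close> has height zero.\<close>

lemma even_in_triple:
  assumes "i < j" "j < k" "k \<le> M" and even: "even_in (v i + v j + v k)"
  shows "h (v k) = h (v i) + h (v j)"
proof (rule ccontr)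
  assume neq: "h (v k) \<noteq> h (v i) + h (v j)"
  obtain s where s: "s \<in> G" "v i + v j + v k = s + s" using even by (auto simp: even_in_def)
  define x y z where "x = s - v k" and "y = s - v j" and "z = s - v i"
  have G: "x \<in> G" "y \<in> G" "z \<in> G"
    using s v_in diff assms by (auto simp: x_def y_def z_def)
  have vi: "v i = x + y" and vj: "v j = x + z" and vk: "v k = y + z"
    using s(2) by (simp_all add: x_def y_def z_def algebra_simps)
  have hs: "h (v i) = h x + h y" "h (v j) = h x + h z" "h (v k) = h y + h z"
    by (simp_all add: vi vj vk h_add)
  have bounds: "0 < h (v i)" "h (v i) < h (v j)" "h (v j) < h (v k)" "h (v k) < 2 * h (v 1)"
    using h_bounds[of i] h_bounds[of k] h_less assms by auto
  \<comment> \<open>The assumed inequality of heights says exactly that \<open>h x\<close> is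
    nonzero, as minimality requires.\<close>
  have nx: "norm (e (v 0)) \<le> norm (e x)"
    using G bounds hs neq M_pos by (intro best) auto
  have ny: "norm (e (v 0)) \<le> norm (e y)"
    using G bounds hs M_pos by (intro best) auto
  \<comment> \<open>The height of \<open>z\<close> need not be below \<open>h (v 1)\<close>, but it
    is below \<open>h (v k)\<close>, so minimality is used at \<open>k - 1\<close>. The resulting
    weaker bound still cancels the error of \<open>v k\<close>.\<close>
  have "norm (e (v (k - 1))) \<le> norm (e z)"
    using G bounds hs assms by (intro best) auto
  then have nz: "norm (e (v k)) \<le> norm (e z)"
    using e_less[of "k - 1" k] assms by auto
  have ni: "norm (e (v i)) \<le> norm (e (v 0))"
    using e_less[of 0 i] assms by (cases "i = 0") auto
  have nj: "norm (e (v j)) < norm (e (v 0))"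
    using e_less[of 0 j] assms by auto
  have "(norm (e x + e y + e z))\<^sup>2 + (norm (e x))\<^sup>2 + (norm (e y))\<^sup>2 + (norm (e z))\<^sup>2 =
    (norm (e (v i)))\<^sup>2 + (norm (e (v j)))\<^sup>2 + (norm (e (v k)))\<^sup>2"
    unfolding vi vj vk e_add power2_norm_eq_inner by (simp add: algebra_simps inner_commute)
  moreover have "(norm (e (v 0)))\<^sup>2 \<le> (norm (e x))\<^sup>2" "(norm (e (v 0)))\<^sup>2 \<le> (norm (e y))\<^sup>2"
    "(norm (e (v k)))\<^sup>2 \<le> (norm (e z))\<^sup>2" "(norm (e (v i)))\<^sup>2 \<le> (norm (e (v 0)))\<^sup>2"
    using nx ny nz ni by (auto intro: power_mono)
  moreover have "(norm (e (v j)))\<^sup>2 < (norm (e (v 0)))\<^sup>2"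
    using nj by (intro power_strict_mono) auto
  ultimately show False using zero_le_power2[of "norm (e x + e y + e z)"] by linarith
qed

text \<open>With all indices positive, the forced equality of heights would make the largest height
  at least \<open>2 * h (v 1)\<close>, contradicting \<open>short\<close>.\<close>

lemma not_even_in_triple:
  assumes "{i, j, k} \<subseteq> {1..M}" "i \<noteq> j" "j \<noteq> k" "i \<noteq> k"
  shows "\<not> even_in (v i + v j + v k)"
proof -
  have ordered: "\<not> even_in (v a + v b + v c)" if "1 \<le> a" "a < b" "b < c" "c \<le> M" for a b c
  proof
    assume "even_in (v a + v b + v c)"
    then have "h (v c) = h (v a) + h (v b)" using even_in_triple that by blast
    moreover have "h (v 1) \<le> h (v a)" using h_less[of 1 a] that by (cases "a = 1") auto
    moreover have "h (v a) < h (v b)" using h_less that by auto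
    ultimately show False using h_bounds(2)[of c] that by linarith
  qed
  show ?thesis
    using assms ordered[of i j k] ordered[of i k j] ordered[of j i k] ordered[of j k i]
      ordered[of k i j] ordered[of k j i]
    by (auto simp: add_ac) (metis linorder_neqE_nat)
qed

text \<open>The classes of \<open>v 1, \<dots>, v M\<close> modulo \<open>2G\<close> form a sum-free half of \<open>G / 2G\<close>, so adding
  \<open>v j\<close> maps them onto the complement, which contains the class of \<open>v 0\<close>.\<close>

lemma partner_exists:
  assumes j: "j \<in> {1..M}"
  obtains a where "a \<in> {1..M}" "a \<noteq> j" "even_in (v 0 + v j + v a)"
proof -
  have sum_of_diff: "even_in (x + y)" if "even_in (x - y)" "y \<in> G" for x y
    using even_in_add[OF that(1) even_in_double[OF that(2)]] by (simp add: algebra_simps)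
  \<comment> \<open>These are 2M+1 elements: \<open>v 0\<close> to \<open>v M\<close>, then
    \<open>v 1 + v j\<close> to \<open>v M + v j\<close>. Two of them are congruent, and
    incongruence of the \<open>v i\<close> forces one to come from each block.\<close>
  define f where "f i = (if i \<le> M then v i else v (i - M) + v j)" for i
  have fG: "f i \<in> G" if "i \<le> 2 * M" for i
    using that j v_in add by (auto simp: f_def)
  then obtain i i' where i: "i < i'" "i' \<le> 2 * M" and "even_in (f i - f i')"
    using pigeonhole[of f] by (auto simp: even_in_def)
  then have ev: "even_in (f i + f i')" using sum_of_diff fG by blast
  have vj: "v j \<in> G" using v_in j by simp
  consider "i' \<le> M" | "i \<le> M" "M < i'" | "M < i" using i by linarith
  then show ?thesis
  proof cases
    case 1
    then show ?thesis using ev not_even_in_add[of i i'] i by (simp add: f_def)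
  next
    case 2
    define a where "a = i' - M"
    have a: "a \<in> {1..M}" using 2 i by (auto simp: a_def)
    have ev': "even_in (v i + v j + v a)" using ev 2 by (simp add: f_def a_def add_ac)
    \<comment> \<open>A repeated index would leave a single \<open>v y\<close> in 2G. So
      \<open>i\<close>, \<open>j\<close>, \<open>a\<close> are distinct, and the absence of triples
      with positive indices leaves only \<open>i = 0\<close>.\<close>
    have twice: "\<not> even_in (v x + v x + v y)" if "x \<le> M" "y \<le> M" for x y
    proof
      assume "even_in (v x + v x + v y)"
      from even_in_diff[OF this even_in_double[OF v_in[OF that(1)]]] show False
        using not_even_in[OF that(2)] by simp
    qed
    have "a \<noteq> j" using twice[of j i] ev' 2 j by (auto simp: add_ac)
    moreover have "i \<noteq> j" using twice[of i a] ev' 2 a by auto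
    moreover have "i \<noteq> a" using twice[of i j] ev' 2 j by (auto simp: add_ac)
    ultimately have "i = 0"
      using not_even_in_triple[of i j a] ev' a j 2 by (cases "i = 0") auto
    then show ?thesis using that[OF a \<open>a \<noteq> j\<close>] ev' by simp
  next
    case 3
    have "even_in (v (i - M) + v (i' - M) + (v j + v j))"
      using ev i 3 by (simp add: f_def add_ac)
    from even_in_diff[OF this even_in_double[OF vj]] show ?thesis
      using not_even_in_add[of "i - M" "i' - M"] i 3 by simp
  qed
qed

text \<open>Two partners of \<open>j\<close> are both congruent to \<open>v 0 + v j\<close>, hence
  to each other.\<close>

lemma partner_unique:
  assumes "even_in (v 0 + v j + v a)" "even_in (v 0 + v j + v b)" "a \<le> M" "b \<le> M"
  shows "a = b"
proof (rule ccontr)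
  assume "a \<noteq> b"
  have "even_in (v a - v b)" using even_in_diff[OF assms(1,2)] by simp
  from even_in_add[OF this even_in_double[OF v_in[OF assms(4)]]] have "even_in (v a + v b)"
    by (simp add: algebra_simps)
  then show False using not_even_in_add[of a b] not_even_in_add[of b a] \<open>a \<noteq> b\<close> assms(3,4)
    by (metis add.commute linorder_neqE_nat)
qed

lemma pairing:
  "\<exists>P. partition_on {1..M} P \<and>
     (\<forall>B\<in>P. \<exists>j k. j < k \<and> B = {j, k} \<and> h (v k) = h (v 0) + h (v j))"
proof (intro exI conjI)
  \<comment> \<open>Existence, uniqueness and symmetry of partners make \<open>R\<close> the graph
    of an involution without fixed points; its orbits are the blocks.\<close>
  define R where "R j k \<longleftrightarrow> j \<in> {1..M} \<and> k \<in> {1..M} \<and> j \<noteq> k \<and> even_in (v 0 + v j + v k)" for j k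
  define P where "P = {{j, k} | j k. R j k}"
  have sym: "R k j" if "R j k" for j k
    using that by (auto simp: R_def add_ac)
  have unique: "k = l" if "R j k" "R j l" for j k l
    using that partner_unique by (auto simp: R_def)
  show "partition_on {1..M} P"
  proof (rule partition_onI)
    show "\<Union> P = {1..M}"
    proof
      show "\<Union> P \<subseteq> {1..M}" by (auto simp: P_def R_def)
      show "{1..M} \<subseteq> \<Union> P"
      proof
        fix j assume "j \<in> {1..M}"
        with partner_exists obtain a where "R j a" unfolding R_def by blast
        then have "{j, a} \<in> P" by (auto simp: P_def)
        then show "j \<in> \<Union> P" by blast
      qed
    qed
    show "disjnt p p'" if P: "p \<in> P" "p' \<in> P" "p \<noteq> p'" for p p'
    proof (rule ccontr)
      assume "\<not> disjnt p p'"
      then obtain l where l: "l \<in> p" "l \<in> p'" by (auto simp: disjnt_def)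
      have block: "\<exists>m. B = {l, m} \<and> R l m" if "B \<in> P" "l \<in> B" for B
        using that sym unfolding P_def by (auto simp: insert_commute)
      show False using block[OF P(1) l(1)] block[OF P(2) l(2)] unique P(3) by blast
    qed
    show "{} \<notin> P" by (auto simp: P_def)
  qed
  show "\<forall>B\<in>P. \<exists>j k. j < k \<and> B = {j, k} \<and> h (v k) = h (v 0) + h (v j)"
  proof
    fix B assume "B \<in> P"
    then obtain j k where B: "B = {j, k}" "R j k" by (auto simp: P_def)
    define a b where "a = min j k" and "b = max j k"
    have "R a b" "B = {a, b}" using B sym by (auto simp: a_def b_def min_def max_def)
    moreover from \<open>R a b\<close> have "a < b" by (auto simp: R_def a_def b_def min_def max_def split: if_splits)
    \<comment> \<open>The triple is taken at the indices 0 < a < b.\<close>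
    ultimately have "h (v b) = h (v 0) + h (v a)"
      by (intro even_in_triple) (auto simp: R_def)
    then show "\<exists>j k. j < k \<and> B = {j, k} \<and> h (v k) = h (v 0) + h (v j)"
      using \<open>a < b\<close> \<open>B = {a, b}\<close> by blast
  qed
qed

end

section \<open>Counting in partitions into pairs\<close>

text \<open>There are M/2 blocks, but M/2 + 1 numbers from M/2 to M, so two of these numbers share a
  block.\<close>

lemma pair_partition_large_lower:
  fixes P :: "nat set set"
  assumes P: "partition_on {1..M} P" and pairs: "\<And>B. B \<in> P \<Longrightarrow> \<exists>j k. j < k \<and> B = {j, k}"
    and M: "2 \<le> M"
  obtains j k where "{j, k} \<in> P" "M div 2 \<le> j" "j < k"
proof (rule ccontr)
  assume "\<not> thesis"
  with that have contra: "\<not> (M div 2 \<le> j \<and> j < k)" if "{j, k} \<in> P" for j k using that by blast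
  have finP: "finite P" using P by (rule finite_elements[rotated]) simp
  have finP': "finite B" if "B \<in> P" for B using pairs[OF that] by auto
  have "M = (\<Sum>B\<in>P. card B)"
    using product_partition[OF P] finP' by simp
  also have "\<dots> = (\<Sum>B\<in>P. 2)"
  proof (rule sum.cong)
    fix B assume "B \<in> P"
    then obtain j k where "j < k" "B = {j, k}" using pairs by blast
    then show "card B = 2" by simp
  qed simp
  finally have card_P: "M = 2 * card P" by simp
  have "\<exists>B. B \<in> P \<and> l \<in> B" if "l \<in> {M div 2..M}" for l
  proof -
    have "l \<in> {1..M}" using that M by auto
    then show ?thesis using partition_onD1[OF P] by blast
  qed
  then obtain f where f: "f l \<in> P \<and> l \<in> f l" if "l \<in> {M div 2..M}" for l by metis
  have "inj_on f {M div 2..M}"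
  proof (rule inj_onI, rule ccontr)
    fix l m assume lm: "l \<in> {M div 2..M}" "m \<in> {M div 2..M}" "f l = f m" "l \<noteq> m"
    obtain j k where "j < k" "f l = {j, k}" using pairs f lm by blast
    then show False using contra[of j k] f[OF lm(1)] f[OF lm(2)] lm by auto
  qed
  then have "card {M div 2..M} \<le> card P"
    using f finP by (intro card_inj_on_le[of f]) auto
  then show False using card_P by simp
qed

section \<open>Minimality of best approximation denominators\<close>

lemma best_denom_downward:
  assumes "best_denom L \<alpha> m \<noteq> None" "1 \<le> i" "i \<le> m"
  shows "best_denom L \<alpha> i \<noteq> None"
  using assms(3,1)
proof (induction m rule: dec_induct)
  case (step m)
  then obtain l where "m = Suc l" using assms(2) by (cases m) auto
  with step show ?case by (auto split: option.splits)
qed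

lemma best_denom_step:
  assumes "best_denom L \<alpha> (Suc i) = Some a" "best_denom L \<alpha> (Suc (Suc i)) = Some b"
  shows "a < b" and "lattice_dist L \<alpha> b < lattice_dist L \<alpha> a"
    and "\<And>m. a < m \<Longrightarrow> m < b \<Longrightarrow> lattice_dist L \<alpha> a \<le> lattice_dist L \<alpha> m"
proof -
  let ?Q = "\<lambda>m. a < m \<and> lattice_dist L \<alpha> m < lattice_dist L \<alpha> a"
  have ex: "\<exists>m. ?Q m" and b: "b = (LEAST m. ?Q m)"
    using assms by (auto split: if_splits)
  have "?Q b" unfolding b using ex by (rule LeastI_ex)
  then show "a < b" "lattice_dist L \<alpha> b < lattice_dist L \<alpha> a" by auto
  show "lattice_dist L \<alpha> a \<le> lattice_dist L \<alpha> m" if "a < m" "m < b" for m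
    using not_less_Least[of m ?Q] that b by fastforce
qed

text \<open>The recursion only compares \<open>a\<close> with larger numbers. For
  \<open>m < a\<close>, induction bounds the distance at \<open>m\<close> below by that at the
  preceding denominator, which exceeds the distance at \<open>a\<close>. The first denominator is 1,
  with nothing positive below it.\<close>

lemma best_denom_minimal:
  assumes "best_denom L \<alpha> (Suc i) = Some a" "best_denom L \<alpha> (Suc (Suc i)) = Some b"
    and "0 < m" "m < b"
  shows "lattice_dist L \<alpha> a \<le> lattice_dist L \<alpha> m"
  using assms
proof (induction i arbitrary: a b)
  case 0
  then show ?case using best_denom_step(3)[OF 0(1,2), of m] by (cases "m = 1") auto
next
  case (Suc i)
  obtain a' where a': "best_denom L \<alpha> (Suc i) = Some a'"
    using best_denom_downward[of L \<alpha> "Suc (Suc i)" "Suc i"] Suc.prems(1) by auto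
  show ?case
  proof (cases "m < a")
    case True
    then have "lattice_dist L \<alpha> a' \<le> lattice_dist L \<alpha> m"
      using Suc.IH[OF a' Suc.prems(1)] Suc.prems by blast
    then show ?thesis using best_denom_step(2)[OF a' Suc.prems(1)] by simp
  next
    case False
    then show ?thesis using best_denom_step(3)[OF Suc.prems(1,2), of m] Suc.prems by (cases "m = a") auto
  qed
qed

lemma best_denom_pos: "best_denom L \<alpha> i = Some a \<Longrightarrow> 0 < a"
proof (induction L \<alpha> i arbitrary: a rule: best_denom.induct)
  case (3 L \<alpha> i)
  then obtain b where b: "best_denom L \<alpha> (Suc i) = Some b" by (auto split: option.splits)
  then show ?case using best_denom_step(1)[OF b 3(2)] by simp
qed auto

section \<open>Alternatives and growth bounds for the denominators\<close>

theorem theorem1p4: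
  fixes L :: "'a::euclidean_space set" and \<alpha> :: 'a and q :: "nat \<Rightarrow> nat" and M n :: nat
  assumes "full_rank_lattice L"
    and "M = 2 ^ DIM('a)"
    and "n \<ge> 1"
    and "best_denom L \<alpha> (n + M) \<noteq> None"
    and "\<And>i. best_denom L \<alpha> i \<noteq> None \<Longrightarrow> best_denom L \<alpha> i = Some (q i)"
  shows "(q (n + M) \<ge> 2 * q (n + 1) \<or>
          (\<exists>P. partition_on {1..M} P \<and>
               (\<forall>B\<in>P. \<exists>j k. j < k \<and> B = {j, k} \<and> q (n + k) = q n + q (n + j)))) \<and>
         q (n + M) \<ge> min (2 * q (n + 1)) (q n + q (n + M div 2)) \<and>
         min (2 * q (n + 1)) (q n + q (n + M div 2)) \<ge> q n + q (n + 1) \<and>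
         q n + q (n + 1) > 2 * q n"
proof -
  let ?\<rho> = "lattice_dist L \<alpha>"
  have M: "2 \<le> M"
    using assms(2) power_increasing[of 1 "DIM('a)" "2::nat"] by (simp add: Suc_leI)
  have bd: "best_denom L \<alpha> (n + i) = Some (q (n + i))" if "i \<le> M" for i
    using assms(5)[OF best_denom_downward[OF assms(4), of "n + i"]] assms(3) that by simp
  obtain n' where n: "n = Suc n'" using assms(3) by (cases n) auto
  have step: "best_denom L \<alpha> (Suc (n' + i)) = Some (q (n + i))"
    "best_denom L \<alpha> (Suc (Suc (n' + i))) = Some (q (n + Suc i))" if "i < M" for i
    using bd[of i] bd[of "Suc i"] that by (simp_all add: n)
  have chain: "q (n + i) < q (n + j) \<and> ?\<rho> (q (n + j)) < ?\<rho> (q (n + i))" if "i < j" "j \<le> M" for i j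
    using that
  proof (induction j)
    case (Suc j)
    then have "j < M" by simp
    note succ = best_denom_step(1,2)[OF step[OF this]]
    show ?case
    proof (cases "i = j")
      case True
      then show ?thesis using succ by simp
    next
      case False
      then have "q (n + i) < q (n + j) \<and> ?\<rho> (q (n + j)) < ?\<rho> (q (n + i))"
        using Suc by simp
      then show ?thesis using succ by (meson less_trans)
    qed
  qed simp
  have q_less: "q (n + i) < q (n + j)" if "i < j" "j \<le> M" for i j
    using chain that by blast
  have q_pos: "0 < q n" using best_denom_pos[OF bd[of 0]] by simp
  have pairs_exist: "\<exists>P. partition_on {1..M} P \<and>
      (\<forall>B\<in>P. \<exists>j k. j < k \<and> B = {j, k} \<and> q (n + k) = q n + q (n + j))"
    if short: "q (n + M) < 2 * q (n + 1)"
  proof -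
    have "\<exists>p. p \<in> L \<and> ?\<rho> m = norm (real m *\<^sub>R \<alpha> - p)" for m
      using lattice_dist_attained[OF assms(1)] by metis
    then obtain p where p: "\<And>m. p m \<in> L" "\<And>m. ?\<rho> m = norm (real m *\<^sub>R \<alpha> - p m)" by metis
    \<comment> \<open>Heights in the group may be negative; since L = -L, the sign of a pair can be
      flipped without changing its error.\<close>
    have lattice_dist_le: "?\<rho> (nat \<bar>m\<bar>) \<le> norm (of_int m *\<^sub>R \<alpha> - x)" if "x \<in> L" for m x
    proof (cases "0 \<le> m")
      case True
      then show ?thesis
        using infdist_le[OF that, of "of_int m *\<^sub>R \<alpha>"] by (simp add: lattice_dist_def dist_norm)
    next
      case False
      have "- x \<in> L" using assms(1) that by (simp add: full_rank_lattice_def)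
      from infdist_le[OF this, of "of_int (- m) *\<^sub>R \<alpha>"] False show ?thesis
        by (simp add: lattice_dist_def dist_norm norm_minus_commute)
    qed
    let ?e = "\<lambda>w. of_int (fst w) *\<^sub>R \<alpha> - snd w"
    let ?v = "\<lambda>i. (int (q (n + i)), p (q (n + i)))"
    interpret best_approximation_chain "UNIV \<times> L" fst ?e ?v M
    proof
      show "0 \<in> UNIV \<times> L" using assms(1) by (simp add: full_rank_lattice_def mem_Times_iff)
      show "x - y \<in> UNIV \<times> L" if "x \<in> UNIV \<times> L" "y \<in> UNIV \<times> L" for x y :: "int \<times> 'a"
        using assms(1) that unfolding full_rank_lattice_def mem_Times_iff
        by (metis UNIV_I diff_conv_add_uminus snd_diff)
      show "norm (?e (?v i)) \<le> norm (?e w)"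
        if "i < M" "w \<in> UNIV \<times> L" "fst w \<noteq> 0" "\<bar>fst w\<bar> < fst (?v (Suc i))" for i w
      proof -
        have "norm (?e (?v i)) = ?\<rho> (q (n + i))" using p(2) by simp
        also have "\<dots> \<le> ?\<rho> (nat \<bar>fst w\<bar>)"
          using that by (intro best_denom_minimal[OF step]) auto
        also have "\<dots> \<le> norm (?e w)" using that by (intro lattice_dist_le) auto
        finally show ?thesis .
      qed
      show "\<exists>i j. i < j \<and> j \<le> 2 * M \<and> (\<exists>w\<in>UNIV \<times> L. f i - f j = w + w)"
        if "\<And>i. i \<le> 2 * M \<Longrightarrow> f i \<in> UNIV \<times> L" for f :: "nat \<Rightarrow> int \<times> 'a"
        using lattice_pigeonhole_mod_2[OF assms(1), of f] that assms(2) by simp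
      show "norm (?e (?v j)) < norm (?e (?v i))" if "i < j" "j \<le> M" for i j
        using chain[OF that] p(2) by simp
    qed (use p(1) q_less q_pos short M in \<open>auto simp: algebra_simps\<close>)
    show ?thesis using pairing by (simp flip: of_nat_add)
  qed
  have mono: "q (n + i) \<le> q (n + j)" if "i \<le> j" "j \<le> M" for i j
    using q_less[of i j] that by (cases "i = j") auto
  have lower: "min (2 * q (n + 1)) (q n + q (n + M div 2)) \<le> q (n + M)"
  proof (cases "q (n + M) < 2 * q (n + 1)")
    case True
    then obtain P where P: "partition_on {1..M} P"
      and pairs: "\<forall>B\<in>P. \<exists>j k. j < k \<and> B = {j, k} \<and> q (n + k) = q n + q (n + j)"
      using pairs_exist by blast
    obtain j k where jk: "{j, k} \<in> P" "M div 2 \<le> j" "j < k"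
      using pair_partition_large_lower[OF P _ M] pairs by metis
    have "{j, k} \<subseteq> {1..M}" using P jk(1) unfolding partition_on_def by blast
    \<comment> \<open>The order \<open>j < k\<close> identifies these numbers with the ones supplied
      by \<open>pairs\<close>. Now \<open>k \<le> M\<close> and \<open>M div 2 \<le> j\<close> give
      the bound by monotonicity.\<close>
    moreover have "q (n + k) = q n + q (n + j)"
      using pairs jk by (fastforce simp: doubleton_eq_iff)
    ultimately show ?thesis
      using mono[of "M div 2" j] mono[of k M] jk by auto
  qed auto
  have "q n < q (n + 1)" using q_less[of 0 1] M by simp
  moreover have "q (n + 1) \<le> q (n + M div 2)" using M by (intro mono) auto
  ultimately have "q n + q (n + 1) \<le> min (2 * q (n + 1)) (q n + q (n + M div 2))"
    "2 * q n < q n + q (n + 1)" by auto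
  then show ?thesis using pairs_exist lower by (meson not_le)
qed

end
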